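(* For the $k$-nearest neighbour model on a Poisson point process in $\mathbb{R}^2$, the critical value satisfies \[k_c(2) \leq 188.\]
   Context: Let $S$ be the point set of a homogeneous Poisson point process of intensity $\lambda>0$ in $\mathbb{R}^2$. The $k$-nearest neighbour graph $\mathrm{NN}(2,k)$ on $S$ is the undirected graph with vertex set $S$ in which, for each $x\in S$, an edge is placed between $x$ and each of the $k$ points of $S\setminus\{x\}$ nearest to $x$ in Euclidean distance. The critical value $k_c(2)$ is the value (depending only on the dimension) such that for $k>k_c(2)$ the graph $\mathrm{NN}(2,k)$ almost surely has an infinite connected component (infinite cluster). *)

theory Defs
  imports "HOL-Probability.Probability"
begin

type_synonym point = "real ^ 2"

text \<open>y is one of the k nearest neighbours of x in the point set S
  (fewer than k points of S other than x are strictly closer to x than y).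
  For locally finite S without distance ties this is exactly the set of the
  k nearest points.\<close>
definition knn_nbr :: "nat \<Rightarrow> point set \<Rightarrow> point \<Rightarrow> point \<Rightarrow> bool" where
  "knn_nbr k S x y \<longleftrightarrow> x \<in> S \<and> y \<in> S \<and> y \<noteq> x \<and>
     finite {z \<in> S - {x}. dist x z < dist x y} \<and>
     card {z \<in> S - {x}. dist x z < dist x y} < k"

definition knn_edge :: "nat \<Rightarrow> point set \<Rightarrow> point \<Rightarrow> point \<Rightarrow> bool" where
  "knn_edge k S x y \<longleftrightarrow> knn_nbr k S x y \<or> knn_nbr k S y x"

definition has_infinite_cluster :: "nat \<Rightarrow> point set \<Rightarrow> bool" where
  "has_infinite_cluster k S \<longleftrightarrow>
     (\<exists>x\<in>S. infinite {y. (knn_edge k S)\<^sup>*\<^sup>* x y})"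

definition poisson_pp :: "'a measure \<Rightarrow> real \<Rightarrow> ('a \<Rightarrow> point set) \<Rightarrow> bool" where
  "poisson_pp M lam S \<longleftrightarrow> prob_space M \<and> lam > 0 \<and>
    (\<forall>A \<in> sets lborel. bounded A \<longrightarrow>
       (AE \<omega> in M. finite (S \<omega> \<inter> A)) \<and>
       (\<lambda>\<omega>. card (S \<omega> \<inter> A)) \<in> measurable M (count_space UNIV) \<and>
       (\<forall>n::nat. measure M {\<omega> \<in> space M. card (S \<omega> \<inter> A) = n} =
          exp (- (lam * measure lborel A)) * (lam * measure lborel A) ^ n / fact n)) \<and>
    (\<forall>(I::nat set) (B::nat \<Rightarrow> point set). finite I \<longrightarrow>
       (\<forall>i\<in>I. B i \<in> sets lborel \<and> bounded (B i)) \<longrightarrow>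
       disjoint_family_on B I \<longrightarrow>
       prob_space.indep_vars M (\<lambda>_. count_space UNIV) (\<lambda>i \<omega>. card (S \<omega> \<inter> B i)) I)"

end

theory Submission
  imports Defs
begin

text \<open>
  Cut the plane into square cells of side \<open>h\<close> with \<open>lam * h\<^sup>2 = ln 6 / 4\<close> and group them into
  \<open>2 \<times> 2\<close> tiles laid out like bricks, so that tile adjacency is the triangular lattice. A tile is good
  if it contains a point of the process and its zone, the \<open>12 \<times> 12\<close> block of cells within distance
  \<open>5 h\<close> in each coordinate, has at most 189 points. Points of adjacent tiles are at distance at most
  \<open>5 h\<close>, so a point of a good tile has every point of an adjacent tile among its 188 nearest
  neighbours; it remains to find an infinite cluster of good tiles.

  If there is none, a parity argument (the triangular lattice is self-matching) yields, for infinitely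
  many \<open>j\<close>, a shortest path of \<open>j + 2\<close> bad tiles starting at \<open>(j + 1, 0)\<close>. A shortest path has no chords,
  so it has at most three continuations at every step, and there are at most \<open>6 * 3 ^ j\<close> candidates.
  With \<open>s ^ 36 = 2\<close>, the indicator of a bad tile is at most
  \<open>0 ^ N(tile) + s ^ (N(zone) - 190)\<close>. Since every cell lies in at most 36 zones, expanding the product
  over the path and using the independence of the cells bounds the probability that all its
  tiles are bad by \<open>(1 / 6 + 6 * s ^ (- 190)) ^ (j + 2)\<close>, where the base is less than \<open>1 / 3\<close>.
  The Borel--Cantelli lemma concludes.
\<close>

subsection \<open>Paths and boundaries in the triangular lattice\<close>

type_synonym site = "int \<times> int"

text \<open>Axial coordinates of the triangular lattice; rotation by 60 degrees sends
  \<open>(p, q)\<close> to \<open>(- q, p + q)\<close>.\<close>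

definition tri_steps :: "site set" where
  "tri_steps = {(1, 0), (-1, 0), (0, 1), (0, -1), (1, -1), (-1, 1)}"

definition tri_adj :: "site \<Rightarrow> site \<Rightarrow> bool" where
  "tri_adj u v \<longleftrightarrow> (fst v - fst u, snd v - snd u) \<in> tri_steps"

lemma tri_adj_sym: "tri_adj u v \<longleftrightarrow> tri_adj v u"
proof -
  have "(- p, - q) \<in> tri_steps" if "(p, q) \<in> tri_steps" for p q
    using that unfolding tri_steps_def by auto
  from this[of "fst v - fst u" "snd v - snd u"] this[of "fst u - fst v" "snd u - snd v"]
  show ?thesis unfolding tri_adj_def by auto
qed

lemma tri_nbrs: "finite {v. tri_adj u v}" "card {v. tri_adj u v} = 6"
proof -
  let ?f = "\<lambda>d. (fst u + fst d, snd u + snd d)"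
  have "v \<in> ?f ` tri_steps" if "tri_adj u v" for v
    using that unfolding tri_adj_def by (rule rev_image_eqI) simp
  hence eq: "{v. tri_adj u v} = ?f ` tri_steps"
    by (auto simp: tri_adj_def)
  have "inj ?f" by (auto intro!: injI simp: prod_eq_iff)
  moreover have "finite tri_steps" "card tri_steps = 6" unfolding tri_steps_def by simp_all
  ultimately show "finite {v. tri_adj u v}" "card {v. tri_adj u v} = 6"
    unfolding eq by (simp_all add: card_image inj_on_subset)
qed

text \<open>Only sites two steps apart on the path are compared. This local form of chordlessness
  lets the count proceed step by step; distinctness is imposed separately in
  \<open>bad_walk\<close>.\<close>

fun induced_path :: "site list \<Rightarrow> bool" where
  "induced_path (a # b # c # r) \<longleftrightarrow>
     tri_adj a b \<and> a \<noteq> c \<and> \<not> tri_adj a c \<and> induced_path (b # c # r)"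
| "induced_path [a, b] \<longleftrightarrow> tri_adj a b"
| "induced_path _ \<longleftrightarrow> True"

lemma continuations:
  assumes "tri_adj a b"
  shows "finite {c. tri_adj b c \<and> a \<noteq> c \<and> \<not> tri_adj a c}"
    and "card {c. tri_adj b c \<and> a \<noteq> c \<and> \<not> tri_adj a c} \<le> 3"
proof -
  \<comment> \<open>with \<open>d = b - a\<close>, the three continuations are the steps \<open>d\<close> and \<open>d\<close> rotated by \<open>\<plusminus>60\<close> degrees\<close>
  define p q where "p = fst b - fst a" and "q = snd b - snd a"
  have sub: "{c. tri_adj b c \<and> a \<noteq> c \<and> \<not> tri_adj a c} \<subseteq>
    {(fst b + p, snd b + q), (fst b - q, snd b + (p + q)), (fst b + (p + q), snd b - p)}"
    (is "?L \<subseteq> ?R")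
  proof
    fix c assume c: "c \<in> ?L"
    define r t where "r = fst c - fst b" and "t = snd c - snd b"
    have "(p, q) \<in> tri_steps"
      using assms unfolding tri_adj_def p_def q_def .
    moreover have "(r, t) \<in> tri_steps"
      using c unfolding tri_adj_def r_def t_def by blast
    moreover have "(p + r, q + t) \<notin> tri_steps"
      using c unfolding tri_adj_def p_def q_def r_def t_def by auto
    moreover have "(p + r, q + t) \<noteq> (0, 0)"
      using c unfolding p_def q_def r_def t_def by (auto simp: prod_eq_iff)
    ultimately have "(r, t) \<in> {(p, q), (- q, p + q), (p + q, - p)}"
      unfolding tri_steps_def by (elim insertE emptyE) simp_all
    thus "c \<in> ?R" unfolding r_def t_def by (cases c) auto
  qed
  show "finite ?L" using sub by (rule finite_subset) simp
  have "card ?L \<le> card ?R" using sub by (intro card_mono) auto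
  also have "\<dots> \<le> 3" by (simp add: card_insert_if)
  finally show "card ?L \<le> 3" .
qed

lemma count_extensions:
  assumes "tri_adj a b"
  shows "finite {l. length l = n \<and> induced_path (a # b # l)}
    \<and> card {l. length l = n \<and> induced_path (a # b # l)} \<le> 3 ^ n"
  using assms
proof (induction n arbitrary: a b)
  case 0
  have "{l. length l = 0 \<and> induced_path (a # b # l)} = {[]}" using 0 by auto
  thus ?case by simp
next
  case (Suc n)
  let ?N = "{c. tri_adj b c \<and> a \<noteq> c \<and> \<not> tri_adj a c}"
  let ?P = "\<lambda>c. {l. length l = n \<and> induced_path (b # c # l)}"
  have adj: "tri_adj b c" if "induced_path (b # c # l)" for c l
    using that by (cases l) auto
  have eq: "{l. length l = Suc n \<and> induced_path (a # b # l)} = (\<Union>c\<in>?N. (#) c ` ?P c)"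
    using Suc.prems by (auto simp: length_Suc_conv image_iff dest: adj)
  note N = continuations[OF Suc.prems]
  have fin: "finite (\<Union>c\<in>?N. (#) c ` ?P c)"
    using N(1) Suc.IH by (intro finite_UN_I finite_imageI) blast+
  have "card (\<Union>c\<in>?N. (#) c ` ?P c) \<le> (\<Sum>c\<in>?N. card ((#) c ` ?P c))"
    by (rule card_UN_le[OF N(1)])
  also have "\<dots> \<le> (\<Sum>c\<in>?N. 3 ^ n)"
  proof (rule sum_mono)
    fix c assume "c \<in> ?N"
    hence "finite (?P c) \<and> card (?P c) \<le> 3 ^ n" by (intro Suc.IH) simp
    thus "card ((#) c ` ?P c) \<le> 3 ^ n" using card_image_le order_trans by blast
  qed
  also have "\<dots> \<le> 3 * 3 ^ n" using N(2) by simp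
  finally show ?case unfolding eq using fin by simp
qed

text \<open>Six first steps, then at most three choices for each of the remaining
  \<open>n\<close>.\<close>

lemma count_induced_paths:
  shows "finite {l. length l = Suc n \<and> induced_path (a # l)}"
    and "card {l. length l = Suc n \<and> induced_path (a # l)} \<le> 6 * 3 ^ n"
proof -
  let ?N = "{b. tri_adj a b}"
  let ?P = "\<lambda>b. {l. length l = n \<and> induced_path (a # b # l)}"
  have adj: "tri_adj a c" if "induced_path (a # c # l)" for c l
    using that by (cases l) auto
  have eq: "{l. length l = Suc n \<and> induced_path (a # l)} = (\<Union>b\<in>?N. (#) b ` ?P b)"
    by (auto simp: length_Suc_conv image_iff dest: adj)
  show "finite {l. length l = Suc n \<and> induced_path (a # l)}"
    unfolding eq using tri_nbrs(1) count_extensions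
    by (intro finite_UN_I finite_imageI) blast+
  have "card (\<Union>b\<in>?N. (#) b ` ?P b) \<le> (\<Sum>b\<in>?N. card ((#) b ` ?P b))"
    by (rule card_UN_le[OF tri_nbrs(1)])
  also have "\<dots> \<le> (\<Sum>b\<in>?N. 3 ^ n)"
  proof (rule sum_mono)
    fix b assume "b \<in> ?N"
    hence "finite (?P b) \<and> card (?P b) \<le> 3 ^ n" by (intro count_extensions) simp
    thus "card ((#) b ` ?P b) \<le> 3 ^ n" using card_image_le order_trans by blast
  qed
  also have "\<dots> \<le> 6 * 3 ^ n" using tri_nbrs(2) by simp
  finally show "card {l. length l = Suc n \<and> induced_path (a # l)} \<le> 6 * 3 ^ n" unfolding eq .
qed

text \<open>The start \<open>m\<close> is free so that the induction can remove the first site; the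
  intended use is \<open>m = 0\<close>.\<close>

lemma induced_path_map_upt:
  assumes "\<And>i. i < n \<Longrightarrow> tri_adj (f i) (f (Suc i))"
    and "\<And>i. Suc i < n \<Longrightarrow> f i \<noteq> f (Suc (Suc i)) \<and> \<not> tri_adj (f i) (f (Suc (Suc i)))"
    and "m \<le> n"
  shows "induced_path (map f [m..<Suc n])"
  using assms(3)
proof (induction "n - m" arbitrary: m rule: less_induct)
  case less
  show ?case
  proof (cases "Suc m < n")
    case True
    have e: "[m..<Suc n] = m # Suc m # Suc (Suc m) # [Suc (Suc (Suc m))..<Suc n]"
      using True by (simp add: upt_conv_Cons del: upt_Suc)
    have e': "[Suc m..<Suc n] = Suc m # Suc (Suc m) # [Suc (Suc (Suc m))..<Suc n]"
      using True by (simp add: upt_conv_Cons del: upt_Suc)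
    have "induced_path (map f [Suc m..<Suc n])"
      using less.hyps[of "Suc m"] True by simp
    thus ?thesis unfolding e e' using assms(1,2) True by simp
  next
    case False
    hence "n = m \<or> n = Suc m" using less.prems by auto
    thus ?thesis using assms(1) by (auto simp: upt_conv_Cons)
  qed
qed

text \<open>A walk of least length has neither repetitions nor chords, since either would give a
  shortcut.\<close>

lemma shortest_path:
  fixes R :: "'b \<Rightarrow> 'b \<Rightarrow> bool"
  assumes "R\<^sup>*\<^sup>* u v"
  obtains n f where "f 0 = u" "f n = v" "\<And>i. i < n \<Longrightarrow> R (f i) (f (Suc i))"
    "inj_on f {..n}" "\<And>i. Suc i < n \<Longrightarrow> \<not> R (f i) (f (Suc (Suc i)))"
proof -
  define n where "n = (LEAST n. (R ^^ n) u v)"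
  have ex: "\<exists>n. (R ^^ n) u v" using assms by (auto simp: rtranclp_power)
  have n: "(R ^^ n) u v" unfolding n_def using LeastI_ex[OF ex] .
  have min: "n \<le> k" if "(R ^^ k) u v" for k unfolding n_def using that by (rule Least_le)
  obtain f where f: "f 0 = u" "f n = v" "\<And>i. i < n \<Longrightarrow> R (f i) (f (Suc i))"
    using n unfolding relpowp_fun_conv by auto
  have seg: "(R ^^ (j - i)) (f i) (f j)" if "i \<le> j" "j \<le> n" for i j
    unfolding relpowp_fun_conv using that f(3) by (intro exI[of _ "\<lambda>k. f (i + k)"]) auto
  \<comment> \<open>Replacing the segment from \<open>i\<close> to \<open>j\<close> by a walk of
    \<open>k\<close> steps cannot beat the minimum. The case \<open>k = 0\<close> gives injectivity;
    \<open>k = 1\<close> with \<open>j = i + 2\<close> excludes chords.\<close>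
  have short: "n \<le> i + k + (n - j)" if "(R ^^ k) (f i) (f j)" "i \<le> j" "j \<le> n" for i j k
  proof (rule min)
    have "(R ^^ i) u (f i)" using seg[of 0 i] that f by simp
    moreover have "(R ^^ (n - j)) (f j) v" using seg[of j n] that f by simp
    ultimately show "(R ^^ (i + k + (n - j))) u v"
      using that(1) by (metis relpowp_trans)
  qed
  have "inj_on f {..n}"
  proof (rule linorder_inj_onI')
    fix i j assume "i \<in> {..n}" "j \<in> {..n}" "i < j"
    thus "f i \<noteq> f j" using short[of 0 i j] by auto
  qed
  moreover have "\<not> R (f i) (f (Suc (Suc i)))" if "Suc i < n" for i
  proof
    assume "R (f i) (f (Suc (Suc i)))"
    hence "(R ^^ 1) (f i) (f (Suc (Suc i)))" by auto
    from short[OF this] that show False by auto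
  qed
  ultimately show thesis using that f by blast
qed

section \<open>Boundaries of finite sets of sites\<close>

text \<open>The number of edges of a row that join \<open>C\<close> to \<open>Q\<close> has the same parity in all rows, because
  every triangle has an even number of such edges.\<close>

lemma row_parity:
  fixes C Q :: "site set" and L :: nat
  defines "k \<equiv> \<lambda>u v. (u \<in> C \<and> v \<in> Q) \<or> (v \<in> C \<and> u \<in> Q)"
  assumes disj: "C \<inter> Q = {}"
    and closed: "\<And>u v w. u \<in> C \<Longrightarrow> v \<in> Q \<Longrightarrow> w \<notin> C \<Longrightarrow> tri_adj v w \<Longrightarrow> tri_adj u w \<Longrightarrow> w \<in> Q"
    and C: "C \<subseteq> {- int L<..<int L} \<times> {- int L<..<int L}"
  shows "even (\<Sum>x<2 * L. of_bool (k (int x - int L, y) (int x - int L + 1, y)) :: nat)"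
proof -
  define h where "h x y = (of_bool (k (x, y) (x + 1, y)) :: nat)" for x y
  define r where "r x y = (of_bool (k (x, y) (x, y + 1)) :: nat)" for x y
  define s where "s x y = (of_bool (k (x + 1, y) (x, y + 1)) :: nat)" for x y
  have tri: "even (of_bool (k u v) + of_bool (k v w) + of_bool (k u w) :: nat)"
    if "tri_adj u v" "tri_adj v w" "tri_adj u w" for u v w
  proof -
    \<comment> \<open>With one vertex in \<open>C\<close> and two outside, \<open>closed\<close>
      passes membership in \<open>Q\<close> between those two, so neither or both of the edges at
      the first vertex count.\<close>
    have key: "v \<in> Q \<longleftrightarrow> w \<in> Q"
      if "u \<in> C" "v \<notin> C" "w \<notin> C" "tri_adj u v" "tri_adj v w" "tri_adj u w" for u v w
      using closed[of u v w] closed[of u w v] that tri_adj_sym[of v w] by blast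
    have "x \<notin> Q" if "x \<in> C" for x using that disj by auto
    with key[of u v w] key[of v u w] key[of w u v] that
      tri_adj_sym[of u v] tri_adj_sym[of v w] tri_adj_sym[of u w]
    show ?thesis unfolding k_def
      by (cases "u \<in> C"; cases "v \<in> C"; cases "w \<in> C") simp_all
  qed
  have t1: "even (h x y + s x y + r x y)" for x y
    unfolding h_def r_def s_def by (rule tri) (auto simp: tri_adj_def tri_steps_def)
  have t2: "even (s x y + h x (y + 1) + r (x + 1) y)" for x y
  proof -
    have "even (of_bool (k (x + 1, y) (x, y + 1)) + of_bool (k (x, y + 1) (x + 1, y + 1))
      + of_bool (k (x + 1, y) (x + 1, y + 1)) :: nat)"
      by (rule tri) (auto simp: tri_adj_def tri_steps_def)
    thus ?thesis unfolding h_def r_def s_def .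
  qed
  \<comment> \<open>Two triangles sharing a diagonal form a lattice square; the diagonal term
    \<open>s x y\<close> cancels modulo 2.\<close>
  have quad: "even (h x y + h x (y + 1) + r x y + r (x + 1) y)" for x y
    using t1[of x y] t2[of x y] by presburger
  have strip: "even ((\<Sum>x<n. h (int x - int L) y) + (\<Sum>x<n. h (int x - int L) (y + 1))
      + r (- int L) y + r (int n - int L) y)" for n y
  proof (induction n)
    case (Suc n)
    have "int (Suc n) - int L = int n - int L + 1" by simp
    with Suc quad[of "int n - int L" y] show ?case
      unfolding sum.lessThan_Suc by presburger
  qed simp
  have side: "r (- int L) y = 0" "r (int (2 * L) - int L) y = 0" for y
    using C unfolding r_def k_def by auto
  define H where "H y = (\<Sum>x<2 * L. h (int x - int L) y)" for y
  have step: "even (H y) \<longleftrightarrow> even (H (y + 1))" for y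
    using strip[where n="2 * L" and y=y] unfolding side H_def by simp
  have up: "even (H y) \<longleftrightarrow> even (H (y + int n))" for y n
  proof (induction n)
    case (Suc n)
    with step[of "y + int n"] show ?case by (simp add: algebra_simps)
  qed simp
  \<comment> \<open>Rows at height \<open>L\<close> or above miss \<open>C\<close> and count no
    edge; \<open>up\<close> carries this parity back to row \<open>y\<close>.\<close>
  have "H (y + int (nat (int L - y))) = 0"
  proof -
    have "y + int (nat (int L - y)) \<ge> int L" by simp
    hence "h x (y + int (nat (int L - y))) = 0" for x
      using C unfolding h_def k_def by auto
    thus ?thesis unfolding H_def by simp
  qed
  with up[of y "nat (int L - y)"] show ?thesis unfolding H_def h_def by simp
qed

definition site_boundary :: "site set \<Rightarrow> site set" where
  "site_boundary C = {v. v \<notin> C \<and> (\<exists>u\<in>C. tri_adj u v)}"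

text \<open>If the part \<open>Q\<close> of the boundary reachable from the positive axis missed the
  negative axis, all \<open>C\<close>-\<open>Q\<close> edges of row 0 would lie on its right half.
  There they are exactly the places where the row enters or leaves \<open>C\<close>, an odd number,
  against \<open>row_parity\<close>.\<close>

lemma boundary_connects_axis:
  assumes "finite C" "(0, 0) \<in> C"
  obtains a b :: int where "a > 0" "b < 0" "(a, 0) \<in> site_boundary C"
    "(\<lambda>u v. tri_adj u v \<and> v \<in> site_boundary C)\<^sup>*\<^sup>* (a, 0) (b, 0)"
proof -
  let ?R = "\<lambda>u v. tri_adj u v \<and> v \<in> site_boundary C"
  define Q where "Q = {v. \<exists>a>0. (a, 0) \<in> site_boundary C \<and> ?R\<^sup>*\<^sup>* (a, 0) v}"
  have QB: "Q \<subseteq> site_boundary C"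
  proof
    fix v assume "v \<in> Q"
    then obtain a where "(a, 0) \<in> site_boundary C" "?R\<^sup>*\<^sup>* (a, 0) v" unfolding Q_def by auto
    thus "v \<in> site_boundary C" by (auto elim: rtranclp.cases)
  qed
  show thesis
  proof (cases "\<exists>b<0. (b, 0) \<in> Q")
    case True
    thus thesis using that unfolding Q_def by auto
  next
    case False
    define L where "L = Suc (Max ((\<lambda>v. nat (max \<bar>fst v\<bar> \<bar>snd v\<bar>)) ` C))"
    have L: "C \<subseteq> {- int L<..<int L} \<times> {- int L<..<int L}"
    proof
      fix v assume "v \<in> C"
      hence "nat (max \<bar>fst v\<bar> \<bar>snd v\<bar>) < L"
        unfolding L_def using assms(1) by (auto simp: less_Suc_eq_le intro: Max_ge)
      thus "v \<in> {- int L<..<int L} \<times> {- int L<..<int L}" by (cases v) auto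
    qed
    have closed: "w \<in> Q" if "u \<in> C" "v \<in> Q" "w \<notin> C" "tri_adj v w" "tri_adj u w" for u v w
    proof -
      have "?R v w" using that by (auto simp: site_boundary_def)
      thus ?thesis using that(2) unfolding Q_def by (auto intro: rtranclp.rtrancl_into_rtrancl)
    qed
    let ?k = "\<lambda>u v. (u \<in> C \<and> v \<in> Q) \<or> (v \<in> C \<and> u \<in> Q)"
    define g where "g x = (of_bool (?k (int x - int L, 0) (int x - int L + 1, 0)) :: nat)" for x
    have even: "even (\<Sum>x<2 * L. g x)"
      unfolding g_def
      by (rule row_parity[OF _ _ L]) (use QB closed in \<open>auto simp: site_boundary_def\<close>)
    \<comment> \<open>The edge ending at the origin is the delicate case: the origin lies in
      \<open>C\<close>, hence not in \<open>Q\<close>.\<close>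
    have neg: "g x = 0" if "x < L" for x
    proof -
      have "(int x - int L, 0) \<notin> Q" using False that by auto
      moreover have "(int x - int L + 1, 0) \<notin> Q"
      proof (cases "x + 1 = L")
        case True
        hence "int x - int L + 1 = 0" by auto
        thus ?thesis using assms(2) QB by (auto simp: site_boundary_def)
      next
        case f: False
        thus ?thesis using that False by auto
      qed
      ultimately show ?thesis unfolding g_def by auto
    qed
    have inQ: "(x, 0) \<in> Q" if "x > 0" "(x, 0) \<notin> C" "(x - 1, 0) \<in> C \<or> (x + 1, 0) \<in> C" for x
    proof -
      have "(x, 0) \<in> site_boundary C" using that by (force simp: site_boundary_def tri_adj_def tri_steps_def)
      thus ?thesis using that unfolding Q_def by blast
    qed
    \<comment> \<open>Every boundary site on the positive axis is itself a starting point of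
      \<open>Q\<close>, so each change of membership in \<open>C\<close> is counted.\<close>
    have pos: "g (L + x) = of_bool (((int x, 0) \<in> C) \<noteq> ((int x + 1, 0) \<in> C))" for x
    proof -
      have Qn: "v \<notin> C" if "v \<in> Q" for v using that QB by (auto simp: site_boundary_def)
      have "(int x, 0) \<in> Q" if "(int x, 0) \<notin> C" "(int x + 1, 0) \<in> C"
        using that assms(2) by (intro inQ) (auto intro: ccontr)
      moreover have "(int x + 1, 0) \<in> Q" if "(int x + 1, 0) \<notin> C" "(int x, 0) \<in> C"
        using that by (intro inQ) auto
      ultimately show ?thesis unfolding g_def using Qn by auto
    qed
    have par: "even (\<Sum>x<n. g (L + x)) \<longleftrightarrow> (int n, 0) \<in> C" for n
    proof (induction n)
      case 0
      thus ?case using assms(2) by simp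
    next
      case (Suc n)
      have "int (Suc n) = int n + 1" by simp
      thus ?case using Suc pos[of n] by (auto simp: add.commute)
    qed
    have split: "(\<Sum>x<L + n. g x) = (\<Sum>x<L. g x) + (\<Sum>x<n. g (L + x))" for n
      by (induction n) auto
    hence "(int L, 0) \<in> C" using even neg par[of L] split[of L] by (simp add: mult_2)
    thus thesis using L by auto
  qed
qed

text \<open>The boundary of the set \<open>C\<close> reached from an axis segment through good sites
  consists of bad sites, and a shortest boundary path crossing the axis starts with the required
  path. The free bound \<open>m\<close> expresses that this happens for infinitely many
  \<open>j\<close>.\<close>

lemma bad_induced_path:
  fixes good :: "site \<Rightarrow> bool"
  assumes fin: "\<And>u. good u \<Longrightarrow> finite {v. (\<lambda>x y. tri_adj x y \<and> good y)\<^sup>*\<^sup>* u v}"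
  obtains j l where "j \<ge> m" "length l = Suc j" "induced_path ((int (Suc j), 0) # l)"
    "distinct ((int (Suc j), 0) # l)" "\<forall>v \<in> set ((int (Suc j), 0) # l). \<not> good v"
proof -
  let ?R = "\<lambda>x y. tri_adj x y \<and> good y"
  \<comment> \<open>Since the segment reaches up to \<open>m\<close>, the positive end
    \<open>a\<close> of the boundary path must lie beyond \<open>m\<close>.\<close>
  define B :: "site set" where "B = (\<lambda>x. (x, 0)) ` {0..int m}"
  define C where "C = {v. \<exists>b\<in>B. ?R\<^sup>*\<^sup>* b v}"
  \<comment> \<open>Finiteness is assumed only for clusters of good sites, while sites of
    \<open>B\<close> may be bad; hence the first step is split off.\<close>
  have "C \<subseteq> B \<union> (\<Union>b\<in>B. \<Union>w\<in>{w. tri_adj b w} \<inter> {w. good w}. {v. ?R\<^sup>*\<^sup>* w v})"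
  proof
    fix v assume "v \<in> C"
    then obtain b where b: "b \<in> B" "?R\<^sup>*\<^sup>* b v" unfolding C_def by auto
    from b(2) show "v \<in> B \<union> (\<Union>b\<in>B. \<Union>w\<in>{w. tri_adj b w} \<inter> {w. good w}. {v. ?R\<^sup>*\<^sup>* w v})"
      using b(1) by (cases rule: converse_rtranclpE) auto
  qed
  moreover have "finite (B \<union> (\<Union>b\<in>B. \<Union>w\<in>{w. tri_adj b w} \<inter> {w. good w}. {v. ?R\<^sup>*\<^sup>* w v}))"
    using tri_nbrs(1) fin unfolding B_def by (intro finite_UnI finite_UN_I finite_imageI finite_Int) auto
  ultimately have finC: "finite C" by (rule finite_subset)
  have BC: "B \<subseteq> C" unfolding C_def by auto
  have bdry: "\<not> good v" if "v \<in> site_boundary C" for v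
  proof
    assume "good v"
    from that obtain u where u: "u \<in> C" "tri_adj u v" "v \<notin> C" unfolding site_boundary_def by auto
    with \<open>good v\<close> show False unfolding C_def by (auto intro: rtranclp.rtrancl_into_rtrancl)
  qed
  have "(0, 0) \<in> C" using BC unfolding B_def by auto
  from boundary_connects_axis[OF finC this] obtain a b :: int where ab: "a > 0" "b < 0"
    "(a, 0) \<in> site_boundary C"
    "(\<lambda>u v. tri_adj u v \<and> v \<in> site_boundary C)\<^sup>*\<^sup>* (a, 0) (b, 0)" .
  obtain f n where f: "f 0 = (a, 0)" "f n = (b, 0)"
    "\<And>i. i < n \<Longrightarrow> tri_adj (f i) (f (Suc i)) \<and> f (Suc i) \<in> site_boundary C"
    "inj_on f {..n}"
    "\<And>i. Suc i < n \<Longrightarrow> \<not> (tri_adj (f i) (f (Suc (Suc i))) \<and> f (Suc (Suc i)) \<in> site_boundary C)"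
    by (rule shortest_path[OF ab(4)]) blast
  have inB: "f i \<in> site_boundary C" if "i \<le> n" for i
    using that f(1,3) ab(3) by (cases i) auto
  \<comment> \<open>Each step lowers the first coordinate by at most 1, so passing from
    \<open>a = j + 1\<close> to \<open>b < 0\<close> takes more than \<open>j + 1\<close> steps and
    the first \<open>j + 2\<close> sites exist.\<close>
  have fst: "fst (f i) \<ge> a - int i" if "i \<le> n" for i
    using that
  proof (induction i)
    case (Suc i)
    have "tri_adj (f i) (f (Suc i))" using f(3) Suc.prems by simp
    hence "fst (f (Suc i)) \<ge> fst (f i) - 1" unfolding tri_adj_def tri_steps_def by auto
    with Suc show ?case by simp
  qed (simp add: f(1))
  have "a > int m"
  proof (rule ccontr)
    assume "\<not> a > int m"
    hence "(a, 0) \<in> B" using ab(1) unfolding B_def by auto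
    thus False using ab(3) BC unfolding site_boundary_def by auto
  qed
  define j where "j = nat a - 1"
  have j: "a = int (Suc j)" "j \<ge> m" using ab(1) \<open>a > int m\<close> unfolding j_def by auto
  have jn: "Suc j \<le> n" using fst[of n] f(2) ab(2) j by auto
  define l where "l = map f [1..<Suc (Suc j)]"
  have l: "(int (Suc j), 0) # l = map f [0..<Suc (Suc j)]"
    unfolding l_def using f(1) j(1) by (simp add: upt_conv_Cons del: upt_Suc)
  have "length l = Suc j" unfolding l_def by simp
  moreover have "induced_path ((int (Suc j), 0) # l)"
    unfolding l
  proof (rule induced_path_map_upt)
    show "tri_adj (f i) (f (Suc i))" if "i < Suc j" for i using f(3)[of i] that jn by simp
    show "f i \<noteq> f (Suc (Suc i)) \<and> \<not> tri_adj (f i) (f (Suc (Suc i)))" if "Suc i < Suc j" for i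
      using f(5)[of i] inB[of "Suc (Suc i)"] inj_onD[OF f(4), of i "Suc (Suc i)"] that jn by auto
  qed simp
  moreover have "distinct ((int (Suc j), 0) # l)"
    unfolding l distinct_map using jn by (auto intro: inj_on_subset[OF f(4)] simp del: upt_Suc)
  moreover have "\<forall>v \<in> set ((int (Suc j), 0) # l). \<not> good v"
    unfolding l using jn inB bdry by (auto simp del: upt_Suc)
  ultimately show thesis using that j(2) by blast
qed

subsection \<open>Tiles and nearest neighbours\<close>

definition cell :: "real \<Rightarrow> site \<Rightarrow> point set" where
  "cell h c = {x. \<lfloor>x $ 1 / h\<rfloor> = fst c \<and> \<lfloor>x $ 2 / h\<rfloor> = snd c}"

text \<open>The shift by \<open>snd u\<close> displaces successive rows of tiles by one cell, half a
  tile, so that the six tiles touching \<open>tile u\<close> are those of the neighbours of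
  \<open>u\<close> under \<open>tri_adj\<close>.\<close>

definition tile :: "site \<Rightarrow> site set" where
  "tile u = {2 * fst u + snd u .. 2 * fst u + snd u + 1} \<times> {2 * snd u .. 2 * snd u + 1}"

definition zone :: "site \<Rightarrow> site set" where
  "zone u = {2 * fst u + snd u - 5 .. 2 * fst u + snd u + 6} \<times> {2 * snd u - 5 .. 2 * snd u + 6}"

definition good_site :: "(site \<Rightarrow> nat) \<Rightarrow> site \<Rightarrow> bool" where
  "good_site N u \<longleftrightarrow> (\<exists>c\<in>tile u. N c > 0) \<and> (\<Sum>c\<in>zone u. N c) \<le> 189"

lemma finite_tile [simp]: "finite (tile u)" and finite_zone [simp]: "finite (zone u)"
  by (simp_all add: tile_def zone_def)

lemma card_tile: "card (tile u) = 4" and card_zone: "card (zone u) = 144"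
  by (simp_all add: tile_def zone_def card_cartesian_product)

lemma tile_disjoint:
  assumes "c \<in> tile u" "c \<in> tile v"
  shows "u = v"
proof -
  have "u = ((fst c - snd c div 2) div 2, snd c div 2)" if "c \<in> tile u" for u
  proof -
    have b: "2 * snd u \<le> snd c" "snd c \<le> 2 * snd u + 1" "2 * fst u + snd u \<le> fst c" "fst c \<le> 2 * fst u + snd u + 1"
      using that by (auto simp: tile_def)
    have s: "snd c div 2 = snd u" using b(1,2) by linarith
    have "(fst c - snd u) div 2 = fst u" using b(3,4) by linarith
    thus ?thesis using s by (simp add: prod_eq_iff)
  qed
  from this[OF assms(1)] this[OF assms(2)] show ?thesis by simp
qed

text \<open>In units of \<open>h\<close>, the coordinates of points of adjacent tiles differ by at
  most 4 and 2, or by at most 3 and 4. The distance is thus at most 5, and a strictly nearer point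
  is less than 5 away in each coordinate.\<close>

lemma nearer_point_in_zone:
  fixes x y z :: point
  assumes h: "h > 0" and x: "x \<in> cell h c" "c \<in> tile u" and y: "y \<in> cell h d" "d \<in> tile v"
    and adj: "tri_adj u v" and z: "z \<in> cell h e" and near: "dist x z < dist x y"
  shows "e \<in> zone u"
proof -
  have d2: "(dist p q)\<^sup>2 = (p $ 1 - q $ 1)\<^sup>2 + (p $ 2 - q $ 2)\<^sup>2" for p q :: point
    by (simp add: dist_vec_def L2_set_def sum_2 dist_real_def)
  define x1 x2 y1 y2 where "x1 = x $ 1 / h" and "x2 = x $ 2 / h" and "y1 = y $ 1 / h" and "y2 = y $ 2 / h"
  define z1 z2 where "z1 = z $ 1 / h" and "z2 = z $ 2 / h"
  obtain i j where u: "u = (i, j)" by (cases u)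
  obtain i' j' where v: "v = (i', j')" by (cases v)
  have fl: "real_of_int a \<le> t \<and> t < real_of_int a + 2" if "a \<le> \<lfloor>t\<rfloor>" "\<lfloor>t\<rfloor> \<le> a + 1" for a t
    using that by linarith
  have X: "real_of_int (2 * i + j) \<le> x1 \<and> x1 < real_of_int (2 * i + j) + 2"
     "real_of_int (2 * j) \<le> x2 \<and> x2 < real_of_int (2 * j) + 2"
    using x unfolding cell_def tile_def u x1_def x2_def by (intro fl; auto)+
  have Y: "real_of_int (2 * i' + j') \<le> y1 \<and> y1 < real_of_int (2 * i' + j') + 2"
     "real_of_int (2 * j') \<le> y2 \<and> y2 < real_of_int (2 * j') + 2"
    using y unfolding cell_def tile_def v y1_def y2_def by (intro fl; auto)+
  have Z: "real_of_int (fst e) \<le> z1" "z1 < real_of_int (fst e) + 1"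
     "real_of_int (snd e) \<le> z2" "z2 < real_of_int (snd e) + 1"
    using z unfolding cell_def z1_def z2_def by (auto simp: floor_eq_iff)
  have "(\<bar>x1 - y1\<bar> \<le> 4 \<and> \<bar>x2 - y2\<bar> \<le> 2) \<or> (\<bar>x1 - y1\<bar> \<le> 3 \<and> \<bar>x2 - y2\<bar> \<le> 4)"
    using X Y adj unfolding tri_adj_def tri_steps_def u v by auto
  hence "(x1 - y1)\<^sup>2 + (x2 - y2)\<^sup>2 \<le> 25"
    using abs_le_square_iff[of "x1 - y1" 4] abs_le_square_iff[of "x2 - y2" 2]
      abs_le_square_iff[of "x1 - y1" 3] abs_le_square_iff[of "x2 - y2" 4] by auto
  moreover have "(dist x y / h)\<^sup>2 = (x1 - y1)\<^sup>2 + (x2 - y2)\<^sup>2"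
    unfolding power_divide d2 x1_def x2_def y1_def y2_def
    by (simp add: add_divide_distrib diff_divide_distrib[symmetric] power_divide)
  ultimately have "(dist x y / h)\<^sup>2 \<le> 5\<^sup>2" by simp
  hence "dist x y / h \<le> 5" by (rule power2_le_imp_le) simp
  hence xz: "dist x z / h < 5" using near h by (smt (verit) divide_strict_right_mono)
  have "\<bar>x1 - z1\<bar> < 5"
  proof -
    have "\<bar>x $ 1 - z $ 1\<bar> \<le> dist x z" using dist_vec_nth_le[of x 1 z] by (simp add: dist_real_def)
    hence "\<bar>x $ 1 - z $ 1\<bar> / h \<le> dist x z / h" using h by (simp add: divide_right_mono)
    thus ?thesis using xz h unfolding x1_def z1_def by (simp add: diff_divide_distrib[symmetric] abs_divide)
  qed
  moreover have "\<bar>x2 - z2\<bar> < 5"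
  proof -
    have "\<bar>x $ 2 - z $ 2\<bar> \<le> dist x z" using dist_vec_nth_le[of x 2 z] by (simp add: dist_real_def)
    hence "\<bar>x $ 2 - z $ 2\<bar> / h \<le> dist x z / h" using h by (simp add: divide_right_mono)
    thus ?thesis using xz h unfolding x2_def z2_def by (simp add: diff_divide_distrib[symmetric] abs_divide)
  qed
  \<comment> \<open>The tile is 2 cells wide, so the strict bounds leave exactly the 5 + 2 + 5
    columns and rows of the zone.\<close>
  ultimately have "real_of_int (2 * i + j - 5) < real_of_int (fst e) + 1"
    "real_of_int (fst e) < real_of_int (2 * i + j + 7)"
    "real_of_int (2 * j - 5) < real_of_int (snd e) + 1"
    "real_of_int (snd e) < real_of_int (2 * j + 7)"
    using X Z by auto
  thus ?thesis unfolding zone_def u by (cases e) auto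
qed

text \<open>The points nearer to \<open>x\<close> than \<open>y\<close> lie in the zone, which also
  holds \<open>x\<close> and \<open>y\<close>, so there are at most 189 - 2 of them. The hypothesis
  \<open>fin\<close> keeps \<open>few\<close> meaningful, since \<open>card\<close> of an infinite
  set is 0.\<close>

lemma knn_nbr_of_adjacent:
  assumes h: "h > 0" and fin: "\<And>c. finite (S \<inter> cell h c)"
    and x: "x \<in> S" "x \<in> cell h c" "c \<in> tile u" and y: "y \<in> S" "y \<in> cell h d" "d \<in> tile v"
    and adj: "tri_adj u v" and few: "(\<Sum>c\<in>zone u. card (S \<inter> cell h c)) \<le> 189"
  shows "knn_nbr 188 S x y"
proof -
  let ?Z = "{z \<in> S - {x}. dist x z < dist x y}"
  let ?U = "\<Union>c\<in>zone u. S \<inter> cell h c"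
  have "u \<noteq> v" using adj by (auto simp: tri_adj_def tri_steps_def)
  hence "c \<noteq> d" using x(3) y(3) tile_disjoint by blast
  hence xy: "x \<noteq> y" using x y by (auto simp: cell_def prod_eq_iff)
  have "c \<in> zone u" using x(3) by (auto simp: tile_def zone_def)
  moreover have "d \<in> zone u" using y(3) adj
    by (cases u; cases v) (auto simp: tile_def zone_def tri_adj_def tri_steps_def)
  ultimately have xyU: "{x, y} \<subseteq> ?U" using x y by auto
  have ZU: "?Z \<subseteq> ?U - {x, y}"
  proof
    fix z assume z: "z \<in> ?Z"
    define e where "e = (\<lfloor>z $ 1 / h\<rfloor>, \<lfloor>z $ 2 / h\<rfloor>)"
    have "z \<in> cell h e" unfolding cell_def e_def by simp
    moreover from this have "e \<in> zone u"
      using nearer_point_in_zone[OF h x(2,3) y(2,3) adj] z by auto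
    ultimately show "z \<in> ?U - {x, y}" using z by auto
  qed
  have finU: "finite ?U" by (rule finite_UN_I[OF finite_zone fin])
  have "card ?Z \<le> card (?U - {x, y})" using ZU finU by (intro card_mono) auto
  also have "\<dots> = card ?U - 2" using xyU xy by (subst card_Diff_subset) auto
  also have "\<dots> \<le> 187" using few card_UN_le[of "zone u" "\<lambda>c. S \<inter> cell h c"] by simp
  finally have "card ?Z < 188" by simp
  moreover have "finite ?Z" using ZU finU finite_subset by (meson finite_Diff)
  ultimately show ?thesis unfolding knn_nbr_def using x y xy by auto
qed

text \<open>One chosen point per good tile turns lattice paths into graph paths; tiles are disjoint,
  so infinitely many tiles give infinitely many points.\<close>

lemma has_infinite_cluster_of_good_sites:
  assumes h: "h > 0" and fin: "\<And>c. finite (S \<inter> cell h c)"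
  defines "good \<equiv> good_site (\<lambda>c. card (S \<inter> cell h c))"
  assumes u: "good u" and inf: "infinite {v. (\<lambda>x y. tri_adj x y \<and> good y)\<^sup>*\<^sup>* u v}"
  shows "has_infinite_cluster 188 S"
proof -
  have "\<exists>x c. x \<in> S \<and> x \<in> cell h c \<and> c \<in> tile v" if g: "good v" for v
  proof -
    obtain c where "c \<in> tile v" "card (S \<inter> cell h c) > 0"
      using g unfolding good_def good_site_def by blast
    moreover from this obtain x where "x \<in> S \<inter> cell h c" by (auto simp: card_gt_0_iff)
    ultimately show ?thesis by blast
  qed
  then obtain p q where pq: "\<And>v. good v \<Longrightarrow> p v \<in> S \<and> p v \<in> cell h (q v) \<and> q v \<in> tile v"
    by metis
  let ?V = "{v. (\<lambda>x y. tri_adj x y \<and> good y)\<^sup>*\<^sup>* u v}"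
  have path: "good v \<and> (knn_edge 188 S)\<^sup>*\<^sup>* (p u) (p v)"
    if "(\<lambda>x y. tri_adj x y \<and> good y)\<^sup>*\<^sup>* u v" for v
    using that
  proof (induction rule: rtranclp_induct)
    case (step v w)
    have g: "good v" "good w" "tri_adj v w" using step by blast+
    have "(\<Sum>c\<in>zone v. card (S \<inter> cell h c)) \<le> 189"
      using g(1) unfolding good_def good_site_def by blast
    hence "knn_nbr 188 S (p v) (p w)"
      using pq[OF g(1)] pq[OF g(2)] g(3)
      by (intro knn_nbr_of_adjacent[OF h fin, where c="q v" and d="q w" and u=v and v=w]) blast+
    hence "knn_edge 188 S (p v) (p w)" unfolding knn_edge_def by simp
    with step g(2) show ?case by (meson rtranclp.rtrancl_into_rtrancl)
  qed (simp add: u)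
  have "inj_on p ?V"
  proof (rule inj_onI)
    fix v w assume vw: "v \<in> ?V" "w \<in> ?V" "p v = p w"
    hence g: "good v" "good w" using path by auto
    have "q v = q w" using pq[OF g(1)] pq[OF g(2)] vw(3) by (auto simp: cell_def prod_eq_iff)
    thus "v = w" using pq[OF g(1)] pq[OF g(2)] tile_disjoint by metis
  qed
  hence "infinite (p ` ?V)" using inf by (simp add: finite_image_iff)
  moreover have "p ` ?V \<subseteq> {y. (knn_edge 188 S)\<^sup>*\<^sup>* (p u) y}" using path by auto
  ultimately have "infinite {y. (knn_edge 188 S)\<^sup>*\<^sup>* (p u) y}" using finite_subset by blast
  thus ?thesis unfolding has_infinite_cluster_def using pq[OF u] by auto
qed

subsection \<open>Percolation of good tiles\<close>

text \<open>A cell leaves six possible values of \<open>j\<close> and then six of \<open>i\<close>.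
  In \<open>A\<close> the coordinate \<open>j\<close> comes first because the range of
  \<open>i\<close> depends on it.\<close>

lemma zone_multiplicity: "finite {u. c \<in> zone u}" "card {u. c \<in> zone u} \<le> 36"
proof -
  obtain x y where c: "c = (x, y)" by (cases c)
  define A where "A = (SIGMA j:{(y - 5) div 2 .. (y - 5) div 2 + 5}. {(x - j - 5) div 2 .. (x - j - 5) div 2 + 5})"
  have "{u. c \<in> zone u} \<subseteq> (\<lambda>(j, i). (i, j)) ` A"
  proof
    fix u assume "u \<in> {u. c \<in> zone u}"
    moreover obtain i j where u: "u = (i, j)" by (cases u)
    ultimately have "2 * i + j - 5 \<le> x" "x \<le> 2 * i + j + 6" "2 * j - 5 \<le> y" "y \<le> 2 * j + 6"
      by (auto simp: zone_def c)
    hence "(j, i) \<in> A" unfolding A_def by auto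
    thus "u \<in> (\<lambda>(j, i). (i, j)) ` A" unfolding u by force
  qed
  moreover have "finite A" unfolding A_def by simp
  moreover have "card A = 36" unfolding A_def by (subst card_SigmaI) auto
  ultimately have sub: "{u. c \<in> zone u} \<subseteq> (\<lambda>(j, i). (i, j)) ` A" and A: "finite A" "card A = 36"
    by blast+
  show "finite {u. c \<in> zone u}" using sub by (rule finite_subset) (simp add: A)
  show "card {u. c \<in> zone u} \<le> 36"
    using card_mono[OF finite_imageI[OF A(1)] sub] card_image_le[OF A(1), of "\<lambda>(j, i). (i, j)"] A(2)
    by linarith
qed

text \<open>The exponent 36 is the bound of \<open>zone_multiplicity\<close>: even a cell counted in
  36 zones gets weight only 2 per point.\<close>

definition root36_two :: real where "root36_two = exp (ln 2 / 36)"

lemma root36_two: "root36_two > 1" "root36_two ^ 36 = 2"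
  unfolding root36_two_def by (simp_all add: exp_of_nat_mult[symmetric])

text \<open>Chord of the convex \<open>exp\<close> between 0 and \<open>ln 2\<close>. A bound linear
  in \<open>k\<close> makes the later estimate depend only on the total number of
  incidences.\<close>

lemma root36_two_power_le:
  assumes "k \<le> 36"
  shows "root36_two ^ k \<le> 1 + real k / 36"
proof -
  define t where "t = real k / 36"
  have "exp ((1 - t) *\<^sub>R 0 + t *\<^sub>R ln 2) \<le> (1 - t) * exp 0 + t * exp (ln 2 :: real)"
    using assms by (intro convex_onD[OF exp_convex]) (auto simp: t_def)
  moreover have "root36_two ^ k = exp (t * ln 2)"
    unfolding root36_two_def t_def by (simp add: exp_of_nat_mult[symmetric])
  ultimately show ?thesis by (simp add: t_def)
qed

text \<open>Comparing 36th powers reduces this to \<open>38 ^ 36 <= 2 ^ 190\<close>. The value 38 is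
  large enough for \<open>1 / 6 + 6 / 38 < 1 / 3\<close>.\<close>

lemma root36_two_power_190: "root36_two ^ 190 \<ge> 38"
proof (rule power_le_imp_le_base[of _ 35])
  have "(root36_two ^ 190) ^ Suc 35 = 2 ^ 190"
    using power_mult[of root36_two 36 190] by (simp add: power_mult[symmetric] root36_two(2))
  thus "38 ^ Suc 35 \<le> (root36_two ^ 190) ^ Suc 35" by simp
qed (use root36_two in simp)

text \<open>Regroups overlapping blocks by cell, so that each cell occurs once and independence of
  the cells applies.\<close>

lemma prod_prod_card:
  fixes f :: "'b \<Rightarrow> real"
  assumes "finite A" "finite U" "\<And>i. i \<in> A \<Longrightarrow> F i \<subseteq> U"
  shows "(\<Prod>i\<in>A. \<Prod>c\<in>F i. f c) = (\<Prod>c\<in>U. f c ^ card {i \<in> A. c \<in> F i})"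
proof -
  have "(\<Prod>i\<in>A. \<Prod>c\<in>F i. f c) = (\<Prod>i\<in>A. \<Prod>c\<in>U. if c \<in> F i then f c else 1)"
  proof (rule prod.cong[OF refl])
    fix i assume "i \<in> A"
    hence "U \<inter> {c. c \<in> F i} = F i" using assms(3) by auto
    thus "(\<Prod>c\<in>F i. f c) = (\<Prod>c\<in>U. if c \<in> F i then f c else 1)"
      using assms(2) by (simp add: prod.If_cases)
  qed
  also have "\<dots> = (\<Prod>c\<in>U. \<Prod>i\<in>A. if c \<in> F i then f c else 1)" by (rule prod.swap)
  also have "\<dots> = (\<Prod>c\<in>U. f c ^ card {i \<in> A. c \<in> F i})"
    using assms(1) by (intro prod.cong) (simp_all add: prod.If_cases Int_def)
  finally show ?thesis .
qed

text \<open>Double counting; it converts total multiplicities into 4 per tile and 144 per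
  zone.\<close>

lemma sum_card_incidence:
  assumes "finite A" "finite U" "\<And>i. i \<in> A \<Longrightarrow> F i \<subseteq> U"
  shows "(\<Sum>c\<in>U. card {i \<in> A. c \<in> F i}) = (\<Sum>i\<in>A. card (F i))"
proof -
  have "(\<Sum>c\<in>U. card {i \<in> A. c \<in> F i}) = (\<Sum>i\<in>A. card {c \<in> U. c \<in> F i})"
    using assms(1,2) by (rule sum_multicount_gen[symmetric, where k="\<lambda>c. card {i \<in> A. c \<in> F i}"]) auto
  also have "\<dots> = (\<Sum>i\<in>A. card (F i))"
  proof (rule sum.cong[OF refl])
    fix i assume "i \<in> A"
    hence "{c \<in> U. c \<in> F i} = F i" using assms(3) by auto
    thus "card {c \<in> U. c \<in> F i} = card (F i)" by simp
  qed
  finally show ?thesis .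
qed

text \<open>Here \<open>\<alpha>\<close> is the mean count of a cell; a tile has four cells, so it
  is empty with probability \<open>exp (- 4 * \<alpha>) = 1 / 6\<close>.\<close>

locale poisson_cells = prob_space M for M :: "'a measure" +
  fixes X :: "site \<Rightarrow> 'a \<Rightarrow> nat" and \<alpha> :: real
  assumes indep: "finite U \<Longrightarrow> indep_vars (\<lambda>_. count_space UNIV) X U"
    and poisson: "prob {\<omega> \<in> space M. X c \<omega> = n} = exp (- \<alpha>) * \<alpha> ^ n / fact n"
    and alpha: "\<alpha> = ln 6 / 4"
begin

section \<open>Exponential moments of the cell counts\<close>

lemma alpha_nonneg: "0 \<le> \<alpha>"
  unfolding alpha by simp

lemma X_measurable [measurable]: "X c \<in> measurable M (count_space UNIV)"
  using indep[of "{c}"] unfolding indep_vars_def2 by simp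

text \<open>Probability generating function of the Poisson law. At \<open>t = 0\<close> the
  convention \<open>0 ^ 0 = 1\<close> makes it the probability of an empty cell.\<close>

lemma nn_integral_power:
  assumes "t \<ge> 0"
  shows "(\<integral>\<^sup>+\<omega>. ennreal (t ^ X c \<omega>) \<partial>M) = ennreal (exp (\<alpha> * (t - 1)))"
proof -
  have "(\<integral>\<^sup>+\<omega>. ennreal (t ^ X c \<omega>) \<partial>M) =
      (\<integral>\<^sup>+\<omega>. (\<Sum>n. ennreal (t ^ n) * indicator {\<omega> \<in> space M. X c \<omega> = n} \<omega>) \<partial>M)"
  proof (rule nn_integral_cong)
    fix \<omega> assume "\<omega> \<in> space M"
    hence "(\<Sum>n. ennreal (t ^ n) * indicator {\<omega> \<in> space M. X c \<omega> = n} \<omega>) =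
        (\<Sum>n\<in>{X c \<omega>}. ennreal (t ^ n) * indicator {\<omega> \<in> space M. X c \<omega> = n} \<omega>)"
      by (intro suminf_finite) auto
    thus "ennreal (t ^ X c \<omega>) = (\<Sum>n. ennreal (t ^ n) * indicator {\<omega> \<in> space M. X c \<omega> = n} \<omega>)"
      using \<open>\<omega> \<in> space M\<close> by simp
  qed
  also have "\<dots> = (\<Sum>n. \<integral>\<^sup>+\<omega>. ennreal (t ^ n) * indicator {\<omega> \<in> space M. X c \<omega> = n} \<omega> \<partial>M)"
    by (rule nn_integral_suminf) measurable
  also have "\<dots> = (\<Sum>n. ennreal (exp (- \<alpha>) * ((\<alpha> * t) ^ n / fact n)))"
  proof (rule suminf_cong)
    fix n
    have "(\<integral>\<^sup>+\<omega>. ennreal (t ^ n) * indicator {\<omega> \<in> space M. X c \<omega> = n} \<omega> \<partial>M) =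
      ennreal (t ^ n) * emeasure M {\<omega> \<in> space M. X c \<omega> = n}"
      by (rule nn_integral_cmult_indicator) measurable
    also have "\<dots> = ennreal (exp (- \<alpha>) * ((\<alpha> * t) ^ n / fact n))"
      unfolding emeasure_eq_measure poisson using assms alpha_nonneg
      by (simp add: ennreal_mult[symmetric] power_mult_distrib mult_ac)
    finally show "(\<integral>\<^sup>+\<omega>. ennreal (t ^ n) * indicator {\<omega> \<in> space M. X c \<omega> = n} \<omega> \<partial>M) =
      ennreal (exp (- \<alpha>) * ((\<alpha> * t) ^ n / fact n))" .
  qed
  also have "\<dots> = ennreal (exp (- \<alpha>) * exp (\<alpha> * t))"
  proof (rule suminf_ennreal_eq)
    show "(\<lambda>n. exp (- \<alpha>) * ((\<alpha> * t) ^ n / fact n)) sums (exp (- \<alpha>) * exp (\<alpha> * t))"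
      using exp_converges[of "\<alpha> * t"] by (intro sums_mult) (simp add: divide_inverse mult.commute)
  qed (use assms alpha_nonneg in simp)
  also have "exp (- \<alpha>) * exp (\<alpha> * t) = exp (\<alpha> * (t - 1))"
    by (simp add: exp_add[symmetric] algebra_simps)
  finally show ?thesis .
qed

text \<open>With \<open>t c\<close> collecting all factors that fall on \<open>c\<close>,
  independence gives a product of \<open>exp (\<alpha> * (t c - 1))\<close> over cells. Bounding
  \<open>t c - 1\<close> linearly in the multiplicities reduces the rest to double counting.\<close>

lemma nn_integral_empty_crowded:
  assumes fin: "finite A" "finite B"
  shows "(\<integral>\<^sup>+\<omega>. ennreal ((\<Prod>u\<in>A. \<Prod>c\<in>tile u. 0 ^ X c \<omega>) *
      (\<Prod>u\<in>B. \<Prod>c\<in>zone u. root36_two ^ X c \<omega>)) \<partial>M)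
    \<le> ennreal ((1 / 6) ^ card A * 6 ^ card B)"
proof -
  define U where "U = (\<Union>u\<in>A. tile u) \<union> (\<Union>u\<in>B. zone u)"
  have U: "finite U" unfolding U_def using fin by auto
  define a where "a c = card {u \<in> A. c \<in> tile u}" for c
  define b where "b c = card {u \<in> B. c \<in> zone u}" for c
  define t where "t c = 0 ^ a c * root36_two ^ b c" for c
  have a1: "a c \<le> 1" for c
  proof -
    have "\<exists>v. {u \<in> A. c \<in> tile u} \<subseteq> {v}" using tile_disjoint by blast
    then obtain v where "{u \<in> A. c \<in> tile u} \<subseteq> {v}" by blast
    hence "card {u \<in> A. c \<in> tile u} \<le> card {v}" by (intro card_mono) auto
    thus ?thesis unfolding a_def by simp
  qed
  have b36: "b c \<le> 36" for c
  proof -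
    have "b c \<le> card {u. c \<in> zone u}"
      unfolding b_def using zone_multiplicity(1) by (intro card_mono) auto
    thus ?thesis using zone_multiplicity(2)[of c] by linarith
  qed
  have t0: "t c \<ge> 0" for c unfolding t_def using root36_two(1) by simp
  \<comment> \<open>If \<open>a c = 1\<close> the left side is -1 whatever \<open>b c\<close> is; if
    \<open>a c = 0\<close> the convexity bound applies.\<close>
  have t: "t c - 1 \<le> real (b c) / 36 - real (a c)" for c
  proof (cases "a c = 0")
    case True
    thus ?thesis unfolding t_def using root36_two_power_le[OF b36[of c]] by simp
  next
    case False
    hence "a c = 1" using a1[of c] by linarith
    thus ?thesis unfolding t_def by simp
  qed
  have "(\<integral>\<^sup>+\<omega>. ennreal ((\<Prod>u\<in>A. \<Prod>c\<in>tile u. 0 ^ X c \<omega>) *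
      (\<Prod>u\<in>B. \<Prod>c\<in>zone u. root36_two ^ X c \<omega>)) \<partial>M) =
      (\<integral>\<^sup>+\<omega>. (\<Prod>c\<in>U. ennreal (t c ^ X c \<omega>)) \<partial>M)"
  proof (rule nn_integral_cong)
    fix \<omega>
    have "(\<Prod>u\<in>A. \<Prod>c\<in>tile u. 0 ^ X c \<omega>) = (\<Prod>c\<in>U. (0 ^ X c \<omega> :: real) ^ a c)"
      unfolding a_def using fin U by (intro prod_prod_card) (auto simp: U_def)
    moreover have "(\<Prod>u\<in>B. \<Prod>c\<in>zone u. root36_two ^ X c \<omega>) = (\<Prod>c\<in>U. (root36_two ^ X c \<omega>) ^ b c)"
      unfolding b_def using fin U by (intro prod_prod_card) (auto simp: U_def)
    ultimately have "(\<Prod>u\<in>A. \<Prod>c\<in>tile u. 0 ^ X c \<omega>) * (\<Prod>u\<in>B. \<Prod>c\<in>zone u. root36_two ^ X c \<omega>) =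
       (\<Prod>c\<in>U. t c ^ X c \<omega>)"
      unfolding t_def
      by (simp add: prod.distrib[symmetric] power_mult_distrib power_mult[symmetric] mult.commute)
    thus "ennreal ((\<Prod>u\<in>A. \<Prod>c\<in>tile u. 0 ^ X c \<omega>) * (\<Prod>u\<in>B. \<Prod>c\<in>zone u. root36_two ^ X c \<omega>)) =
      (\<Prod>c\<in>U. ennreal (t c ^ X c \<omega>))"
      using t0 by (simp add: prod_ennreal)
  qed
  also have "\<dots> = (\<Prod>c\<in>U. \<integral>\<^sup>+\<omega>. ennreal (t c ^ X c \<omega>) \<partial>M)"
    using U by (intro indep_vars_nn_integral indep_vars_compose2[OF indep[OF U]]) auto
  also have "\<dots> = ennreal (\<Prod>c\<in>U. exp (\<alpha> * (t c - 1)))"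
    using t0 by (simp add: nn_integral_power prod_ennreal)
  also have "\<dots> \<le> ennreal (\<Prod>c\<in>U. exp (\<alpha> * (real (b c) / 36 - real (a c))))"
    using t alpha_nonneg by (intro ennreal_leI prod_mono) (auto intro!: mult_left_mono)
  also have "(\<Prod>c\<in>U. exp (\<alpha> * (real (b c) / 36 - real (a c)))) =
      exp (\<alpha> * (real (\<Sum>c\<in>U. b c) / 36 - real (\<Sum>c\<in>U. a c)))"
    using U by (simp add: exp_sum[symmetric] sum_distrib_left sum_subtractf sum_divide_distrib algebra_simps)
  \<comment> \<open>In the exponent a zone contributes \<open>144 / 36 = 4\<close> and a tile -4, in
    units of \<open>\<alpha>\<close>; as \<open>4 * \<alpha> = ln 6\<close>, the factors are 6 and
    \<open>1 / 6\<close>.\<close>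
  also have "(\<Sum>c\<in>U. b c) = card B * 144"
    unfolding b_def using fin U by (subst sum_card_incidence) (auto simp: U_def card_zone)
  also have "(\<Sum>c\<in>U. a c) = card A * 4"
    unfolding a_def using fin U by (subst sum_card_incidence) (auto simp: U_def card_tile)
  also have "exp (\<alpha> * (real (card B * 144) / 36 - real (card A * 4))) = (1 / 6) ^ card A * 6 ^ card B"
  proof -
    have "\<alpha> * (real (card B * 144) / 36 - real (card A * 4)) = real (card B) * ln 6 - real (card A) * ln 6"
      unfolding alpha by (simp add: field_simps)
    thus ?thesis by (simp only: exp_diff exp_of_nat_mult) (simp add: power_divide)
  qed
  finally show ?thesis .
qed

text \<open>By \<open>0 ^ 0 = 1\<close> the first product is the indicator of an empty tile; the
  second term is a Chernoff weight for at least 190 points in the zone.\<close>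

definition weight :: "site \<Rightarrow> 'a \<Rightarrow> real" where
  "weight u \<omega> = (\<Prod>c\<in>tile u. 0 ^ X c \<omega>) + (\<Prod>c\<in>zone u. root36_two ^ X c \<omega>) / root36_two ^ 190"

lemma weight_measurable [measurable]: "weight u \<in> borel_measurable M"
  unfolding weight_def by measurable

lemma weight_ge_1:
  assumes "\<not> good_site (\<lambda>c. X c \<omega>) u"
  shows "weight u \<omega> \<ge> 1"
proof -
  have r0: "root36_two > 0" using root36_two(1) by simp
  have nonneg: "(\<Prod>c\<in>tile u. 0 ^ X c \<omega> :: real) \<ge> 0" "(\<Prod>c\<in>zone u. root36_two ^ X c \<omega>) / root36_two ^ 190 \<ge> 0"
    using r0 by (auto intro!: prod_nonneg divide_nonneg_nonneg)
  from assms consider "\<forall>c\<in>tile u. X c \<omega> = 0" | "(\<Sum>c\<in>zone u. X c \<omega>) \<ge> 190"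
    unfolding good_site_def by force
  thus ?thesis
  proof cases
    case 1
    hence "(\<Prod>c\<in>tile u. 0 ^ X c \<omega> :: real) = 1" by simp
    thus ?thesis using nonneg unfolding weight_def by simp
  next
    case 2
    have "(\<Prod>c\<in>zone u. root36_two ^ X c \<omega>) = root36_two ^ (\<Sum>c\<in>zone u. X c \<omega>)" by (simp add: power_sum)
    also have "\<dots> \<ge> root36_two ^ 190" using 2 root36_two(1) by (intro power_increasing) auto
    finally show ?thesis using nonneg r0 unfolding weight_def by (simp add: add_increasing)
  qed
qed

text \<open>Markov's inequality at level 1. Expanding the product sums over the set \<open>A\<close>
  of tiles charged to emptiness, the others being charged to crowding.\<close>

lemma prob_all_bad_le:
  assumes "finite T"
  shows "prob {\<omega> \<in> space M. 1 \<le> (\<Prod>u\<in>T. weight u \<omega>)} \<le> (1 / 6 + 6 / 38) ^ card T"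
proof -
  have r0: "root36_two > 0" using root36_two(1) by simp
  let ?e = "\<lambda>u \<omega>. (\<Prod>c\<in>tile u. 0 ^ X c \<omega> :: real)"
  let ?f = "\<lambda>u \<omega>. (\<Prod>c\<in>zone u. root36_two ^ X c \<omega>)"
  have e0: "?e u \<omega> \<ge> 0" and f0: "?f u \<omega> \<ge> 0" for u \<omega>
    using r0 by (auto intro!: prod_nonneg)
  have nonneg: "0 \<le> (\<Prod>u\<in>A. ?e u \<omega>) * (\<Prod>u\<in>B. ?f u \<omega>)" for A B \<omega>
    using e0 f0 by (simp add: prod_nonneg)
  have expand: "(\<Prod>u\<in>T. weight u \<omega>) =
      (\<Sum>A\<in>Pow T. (1 / root36_two ^ 190) ^ card (T - A) * ((\<Prod>u\<in>A. ?e u \<omega>) * (\<Prod>u\<in>T - A. ?f u \<omega>)))" for \<omega>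
    unfolding weight_def prod_add[OF assms]
    by (intro sum.cong) (simp_all add: prod_dividef power_one_over)
  have "emeasure M {\<omega> \<in> space M. 1 \<le> (\<Prod>u\<in>T. weight u \<omega>)} =
      emeasure M {\<omega> \<in> space M. 1 \<le> 1 * ennreal (\<Prod>u\<in>T. weight u \<omega>)}"
    by (intro arg_cong[where f="emeasure M"]) (auto simp: ennreal_ge_1)
  also have "\<dots> \<le> 1 * (\<integral>\<^sup>+\<omega>. ennreal (\<Prod>u\<in>T. weight u \<omega>) * indicator (space M) \<omega> \<partial>M)"
    by (intro nn_integral_Markov_inequality) auto
  also have "\<dots> = (\<integral>\<^sup>+\<omega>. ennreal (\<Prod>u\<in>T. weight u \<omega>) \<partial>M)"
    by (auto intro: nn_integral_cong)
  also have "\<dots> = (\<integral>\<^sup>+\<omega>. (\<Sum>A\<in>Pow T. ennreal ((1 / root36_two ^ 190) ^ card (T - A)) *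
      ennreal ((\<Prod>u\<in>A. ?e u \<omega>) * (\<Prod>u\<in>T - A. ?f u \<omega>))) \<partial>M)"
    unfolding expand using nonneg r0
    by (intro nn_integral_cong) (simp add: ennreal_mult[symmetric] sum_ennreal)
  also have "\<dots> = (\<Sum>A\<in>Pow T. ennreal ((1 / root36_two ^ 190) ^ card (T - A)) *
      (\<integral>\<^sup>+\<omega>. ennreal ((\<Prod>u\<in>A. ?e u \<omega>) * (\<Prod>u\<in>T - A. ?f u \<omega>)) \<partial>M))"
    by (subst nn_integral_sum) (auto intro!: sum.cong nn_integral_cmult)
  also have "\<dots> \<le> (\<Sum>A\<in>Pow T. ennreal ((1 / 38) ^ card (T - A)) *
      ennreal ((1 / 6) ^ card A * 6 ^ card (T - A)))"
  proof (intro sum_mono mult_mono ennreal_leI power_mono)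
    show "1 / root36_two ^ 190 \<le> 1 / 38" using root36_two_power_190 by (intro divide_left_mono) auto
    fix A assume "A \<in> Pow T"
    hence "finite A" "finite (T - A)" using assms finite_subset by auto
    thus "(\<integral>\<^sup>+\<omega>. ennreal ((\<Prod>u\<in>A. ?e u \<omega>) * (\<Prod>u\<in>T - A. ?f u \<omega>)) \<partial>M)
      \<le> ennreal ((1 / 6) ^ card A * 6 ^ card (T - A))"
      by (rule nn_integral_empty_crowded)
  qed (use r0 in auto)
  \<comment> \<open>An empty tile costs \<open>1 / 6\<close> and a crowded one
    \<open>6 / 38\<close>; the sum over subsets now folds back into a power.\<close>
  also have "\<dots> = ennreal (\<Sum>A\<in>Pow T. (\<Prod>u\<in>A. 1 / 6) * (\<Prod>u\<in>T - A. 6 / 38))"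
  proof -
    have eq: "ennreal ((1 / 38) ^ n) * ennreal ((1 / 6) ^ k * 6 ^ n) = ennreal ((1 / 6) ^ k * (6 / 38) ^ n)" for k n
    proof -
      have "ennreal ((1 / 38) ^ n) * ennreal ((1 / 6) ^ k * 6 ^ n) = ennreal ((1 / 38) ^ n * ((1 / 6) ^ k * 6 ^ n))"
        by (rule ennreal_mult[symmetric]) auto
      also have "(1 / 38) ^ n * ((1 / 6) ^ k * 6 ^ n) = (1 / 6) ^ k * (6 / 38 :: real) ^ n"
        by (simp only: power_divide power_one) simp
      finally show ?thesis .
    qed
    show ?thesis unfolding eq prod_constant by (rule sum_ennreal) simp
  qed
  also have "\<dots> = ennreal ((1 / 6 + 6 / 38) ^ card T)"
    unfolding prod_add[OF assms, symmetric] by simp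
  finally show ?thesis by (simp add: emeasure_eq_measure)
qed

text \<open>Phrased through \<open>weight\<close> so that \<open>prob_all_bad_le\<close> applies; by
  \<open>weight_ge_1\<close> the event occurs whenever all tiles of such a path are bad.
  Distinctness ensures that \<open>j + 2\<close> different tiles enter the product.\<close>

definition bad_walk :: "nat \<Rightarrow> 'a set" where
  "bad_walk j = (\<Union>l\<in>{l. length l = Suc j \<and> induced_path ((int (Suc j), 0) # l) \<and> distinct ((int (Suc j), 0) # l)}.
     {\<omega> \<in> space M. 1 \<le> (\<Prod>u\<in>set ((int (Suc j), 0) # l). weight u \<omega>)})"

lemma bad_walk:
  defines "q \<equiv> 1 / 6 + 6 / 38 :: real"
  shows "bad_walk j \<in> events" and "prob (bad_walk j) \<le> 6 * q\<^sup>2 * (3 * q) ^ j"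
proof -
  let ?a = "(int (Suc j), 0) :: site"
  let ?P = "{l. length l = Suc j \<and> induced_path (?a # l) \<and> distinct (?a # l)}"
  let ?E = "\<lambda>l. {\<omega> \<in> space M. 1 \<le> (\<Prod>u\<in>set (?a # l). weight u \<omega>)}"
  have sub: "?P \<subseteq> {l. length l = Suc j \<and> induced_path (?a # l)}" by auto
  have fin: "finite ?P" using sub count_induced_paths(1) by (rule finite_subset)
  have card: "card ?P \<le> 6 * 3 ^ j"
    using card_mono[OF count_induced_paths(1) sub] count_induced_paths(2)[of j ?a] by linarith
  have meas: "?E l \<in> events" for l by measurable
  show "bad_walk j \<in> events" unfolding bad_walk_def using fin meas by blast
  have "prob (bad_walk j) \<le> (\<Sum>l\<in>?P. prob (?E l))"
    unfolding bad_walk_def using fin meas by (intro finite_measure_subadditive_finite) auto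
  also have "\<dots> \<le> (\<Sum>l\<in>?P. q ^ (j + 2))"
  proof (rule sum_mono)
    fix l assume l: "l \<in> ?P"
    hence "card (set (?a # l)) = j + 2" by (subst distinct_card) auto
    thus "prob (?E l) \<le> q ^ (j + 2)" using prob_all_bad_le[of "set (?a # l)"] unfolding q_def by simp
  qed
  also have "\<dots> = real (card ?P) * q ^ (j + 2)" by simp
  also have "\<dots> \<le> real (6 * 3 ^ j) * q ^ (j + 2)"
    using card by (intro mult_right_mono) (simp_all only: of_nat_le_iff, simp add: q_def)
  also have "\<dots> = 6 * q\<^sup>2 * (3 * q) ^ j" by (simp add: power_add power_mult_distrib power2_eq_square)
  finally show "prob (bad_walk j) \<le> 6 * q\<^sup>2 * (3 * q) ^ j" .
qed

text \<open>By Borel-Cantelli almost surely no \<open>bad_walk j\<close> occurs from some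
  \<open>m\<close> on, whereas finite good clusters would produce one with \<open>j\<close> at least
  \<open>m\<close>.\<close>

lemma AE_infinite_good_cluster:
  "AE \<omega> in M. \<exists>u. good_site (\<lambda>c. X c \<omega>) u \<and>
     infinite {v. (\<lambda>x y. tri_adj x y \<and> good_site (\<lambda>c. X c \<omega>) y)\<^sup>*\<^sup>* u v}"
proof -
  have "summable (\<lambda>j. prob (bad_walk j))"
  proof (rule summable_comparison_test')
    \<comment> \<open>The ratio of this geometric series is \<open>37 / 38\<close>.\<close>
    show "summable (\<lambda>j. 6 * (1 / 6 + 6 / 38 :: real)\<^sup>2 * (3 * (1 / 6 + 6 / 38)) ^ j)"
      by (intro summable_mult summable_geometric) simp
    show "norm (prob (bad_walk j)) \<le> 6 * (1 / 6 + 6 / 38)\<^sup>2 * (3 * (1 / 6 + 6 / 38)) ^ j" if "j \<ge> 0" for j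
      using bad_walk(2)[of j] by simp
  qed
  hence "AE \<omega> in M. eventually (\<lambda>j. \<omega> \<in> space M - bad_walk j) sequentially"
    using bad_walk(1) by (intro borel_cantelli_AE1) (auto simp: less_top[symmetric])
  thus ?thesis
  proof (rule AE_mp, intro AE_I2 impI)
    fix \<omega> assume \<omega>: "\<omega> \<in> space M" and ev: "eventually (\<lambda>j. \<omega> \<in> space M - bad_walk j) sequentially"
    let ?good = "good_site (\<lambda>c. X c \<omega>)"
    from ev obtain m where m: "\<And>j. j \<ge> m \<Longrightarrow> \<omega> \<notin> bad_walk j" by (auto simp: eventually_sequentially)
    show "\<exists>u. ?good u \<and> infinite {v. (\<lambda>x y. tri_adj x y \<and> ?good y)\<^sup>*\<^sup>* u v}"
    proof (rule ccontr)
      assume "\<not> ?thesis"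
      hence fin: "finite {v. (\<lambda>x y. tri_adj x y \<and> ?good y)\<^sup>*\<^sup>* u v}" if "?good u" for u
        using that by blast
      obtain j l where jl: "j \<ge> m" "length l = Suc j" "induced_path ((int (Suc j), 0) # l)"
        "distinct ((int (Suc j), 0) # l)" "\<forall>v \<in> set ((int (Suc j), 0) # l). \<not> ?good v"
        by (rule bad_induced_path[of ?good m, OF fin])
      have "1 \<le> (\<Prod>u\<in>set ((int (Suc j), 0) # l). weight u \<omega>)"
        using jl(5) weight_ge_1 by (intro prod_ge_1) blast
      hence "\<omega> \<in> bad_walk j" unfolding bad_walk_def using jl(2-4) \<omega> by blast
      thus False using m jl(1) by blast
    qed
  qed
qed

end

subsection \<open>The Poisson process\<close>

text \<open>The half-open cell lies between an open and a closed box of the same measure.\<close>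

lemma cell_lborel:
  assumes "h > 0"
  shows "cell h c \<in> sets lborel" "bounded (cell h c)" "measure lborel (cell h c) = h\<^sup>2"
proof -
  define a :: point where "a = (\<chi> i. if i = 1 then h * of_int (fst c) else h * of_int (snd c))"
  define b :: point where "b = (\<chi> i. a $ i + h)"
  have cell: "cell h c = {x. a $ 1 \<le> x $ 1 \<and> x $ 1 < b $ 1 \<and> a $ 2 \<le> x $ 2 \<and> x $ 2 < b $ 2}"
    unfolding cell_def a_def b_def using assms by (auto simp: floor_eq_iff field_simps)
  have sub: "box a b \<subseteq> cell h c" "cell h c \<subseteq> cbox a b"
    unfolding cell by (auto simp: mem_box_cart forall_2 less_imp_le)
  show m: "cell h c \<in> sets lborel" unfolding cell by measurable
  show "bounded (cell h c)" using sub(2) bounded_cbox bounded_subset by blast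
  have ab: "\<forall>i\<in>Basis. a \<bullet> i \<le> b \<bullet> i"
    using assms by (auto simp: Basis_vec_def inner_axis b_def)
  have "cbox a b \<noteq> {}" using ab by (simp add: box_ne_empty)
  hence "measure lborel (cbox a b) = h\<^sup>2"
    by (subst content_cbox_cart) (simp_all add: b_def prod_2 power2_eq_square)
  moreover have "measure lborel (box a b) = measure lborel (cbox a b)"
    using ab by (simp add: measure_lborel_box_eq measure_lborel_cbox_eq)
  moreover have "measure lborel (box a b) \<le> measure lborel (cell h c)"
    using sub m fmeasurableI2[OF fmeasurable_cbox sub(2)] by (intro measure_mono_fmeasurable) auto
  moreover have "measure lborel (cell h c) \<le> measure lborel (cbox a b)"
    using sub m by (intro measure_mono_fmeasurable) auto
  ultimately show "measure lborel (cell h c) = h\<^sup>2" by simp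
qed

text \<open>Needed because \<open>poisson_pp\<close> states independence for families indexed by
  naturals, while cells are indexed by pairs of integers.\<close>

lemma (in prob_space) indep_vars_reindex:
  assumes "inj_on f I" "indep_vars (\<lambda>_. N) (\<lambda>i. X (g i)) (f ` I)" "\<And>i. i \<in> I \<Longrightarrow> g (f i) = i"
  shows "indep_vars (\<lambda>_. N) X I"
  unfolding indep_vars_def2
proof (intro conjI ballI indep_setsI)
  have rv: "\<And>i. i \<in> I \<Longrightarrow> random_variable N (X i)"
    using assms(2,3) unfolding indep_vars_def2 by auto
  thus "random_variable N (X i)" if "i \<in> I" for i using that .
  show "{X i -` A \<inter> space M |A. A \<in> sets N} \<subseteq> events" if "i \<in> I" for i
    using measurable_sets[OF rv[OF that]] by auto
  fix A J assume J: "J \<noteq> {}" "J \<subseteq> I" "finite J" "\<forall>j\<in>J. A j \<in> {X j -` A \<inter> space M |A. A \<in> sets N}"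
  have ind: "indep_sets (\<lambda>i. {X (g i) -` A \<inter> space M |A. A \<in> sets N}) (f ` I)"
    using assms(2) unfolding indep_vars_def2 by auto
  have gf: "g (f j) = j" if "j \<in> J" for j using assms(3) J(2) that by auto
  have "prob (\<Inter>k\<in>f ` J. A (g k)) = (\<Prod>k\<in>f ` J. prob (A (g k)))"
    by (rule indep_setsD[OF ind]) (use J gf in auto)
  moreover have "(\<Inter>k\<in>f ` J. A (g k)) = (\<Inter>j\<in>J. A j)" using gf by auto
  moreover have "(\<Prod>k\<in>f ` J. prob (A (g k))) = (\<Prod>j\<in>J. prob (A j))"
    using inj_on_subset[OF assms(1) J(2)] gf by (simp add: prod.reindex)
  ultimately show "prob (\<Inter>j\<in>J. A j) = (\<Prod>j\<in>J. prob (A j))" by simp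
qed

theorem theorem1:
  fixes M :: "'a measure" and lam :: real and S :: "'a \<Rightarrow> point set"
  assumes "poisson_pp M lam S"
  shows "AE \<omega> in M. has_infinite_cluster 188 (S \<omega>)"
proof -
  have lam: "lam > 0" and ps: "prob_space M" using assms unfolding poisson_pp_def by blast+
  \<comment> \<open>The side is chosen so that a cell has mean count
    \<open>ln 6 / 4\<close>.\<close>
  define h where "h = sqrt (ln 6 / 4 / lam)"
  have h: "h > 0" and h2: "lam * h\<^sup>2 = ln 6 / 4" unfolding h_def using lam by simp_all
  have indep: "prob_space.indep_vars M (\<lambda>_. count_space UNIV) (\<lambda>i \<omega>. card (S \<omega> \<inter> B i)) I"
    if "finite I" "\<forall>i\<in>I. B i \<in> sets lborel \<and> bounded (B i)" "disjoint_family_on B I"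
    for I :: "nat set" and B
    using assms that unfolding poisson_pp_def by simp
  note cell = cell_lborel[OF h]
  define X where "X c \<omega> = card (S \<omega> \<inter> cell h c)" for c \<omega>
  have fin: "AE \<omega> in M. finite (S \<omega> \<inter> cell h c)" for c
    using assms cell[of c] unfolding poisson_pp_def by blast
  \<comment> \<open>On the image of \<open>to_nat\<close>, distinct indices decode to distinct sites
    and hence to disjoint cells.\<close>
  have disj: "disjoint_family_on (\<lambda>n. cell h (from_nat n)) (to_nat ` U)" for U :: "site set"
    unfolding disjoint_family_on_def cell_def by (auto simp: prod_eq_iff)
  interpret prob_space M by (rule ps)
  interpret poisson_cells M X "ln 6 / 4"
  proof
    fix U :: "site set" assume "finite U"
    hence "indep_vars (\<lambda>_. count_space UNIV) (\<lambda>n. X (from_nat n)) (to_nat ` U)"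
      unfolding X_def using cell disj by (intro indep) auto
    thus "indep_vars (\<lambda>_. count_space UNIV) X U"
      by (rule indep_vars_reindex[where f=to_nat and g=from_nat, rotated]) auto
  next
    fix c n
    have "prob {\<omega> \<in> space M. X c \<omega> = n} =
      exp (- (lam * measure lborel (cell h c))) * (lam * measure lborel (cell h c)) ^ n / fact n"
      using assms cell[of c] unfolding poisson_pp_def X_def by blast
    thus "prob {\<omega> \<in> space M. X c \<omega> = n} = exp (- (ln 6 / 4)) * (ln 6 / 4) ^ n / fact n"
      unfolding cell(3) h2 .
  qed simp
  \<comment> \<open>There are countably many cells, so the exceptional null sets can be
    united.\<close>
  have "AE \<omega> in M. \<forall>c. finite (S \<omega> \<inter> cell h c)"
    using fin by (simp add: AE_all_countable)
  thus ?thesis using AE_infinite_good_cluster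
  proof eventually_elim
    case (elim \<omega>)
    thus ?case using has_infinite_cluster_of_good_sites[OF h, of "S \<omega>"] unfolding X_def by blast
  qed
qed

end
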